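(* Let $t\ge1$, $r\ge1$, and write $t=2m+2$ if $t$ is even, $t=2m'+1$ if $t$ is odd; let $\xi=e^{2\pi i/t}$, $R=r+m$ and $R'=r+m'$. For the same $\beta$, $$\Phi_{t,r}=\Phi_{2,R}\Big|_{y=(\xi,\xi^2,\dots,\xi^m)}\ (t\text{ even}),\qquad \Phi_{t,r}=\Phi_{1,R'}\Big|_{y=(\xi,\xi^2,\dots,\xi^{m'})}\ (t\text{ odd}),$$ where $y$ denotes the first $m$ (respectively $m'$) free variables of the right-hand object and its remaining $r$ variables are left free. In both cases $N$ is unchanged: $2+2R=t+2r$ and $1+2R'=t+2r$.
   Context: For $t,r\ge1$ put $N=t+2r$, $\zeta=e^{2\pi i/t}$, $\delta=(N-1,N-2,\dots,0)$. For a strictly decreasing $\beta\in\mathbb Z^N$ with $\beta_N=0$, let $\lambda=\beta-\delta$ (a partition). Define $$\Phi_{t,r}(\beta)=\frac{\det(x_i^{\beta_j})_{i,j=1}^N}{\det(x_i^{\delta_j})_{i,j=1}^N}=s_\lambda(x),\qquad x=(1,\zeta,\dots,\zeta^{t-1},z_1,z_1^{-1},\dots,z_r,z_r^{-1}),$$ i.e. the Schur polynomial $s_\lambda$ in $N$ variables at all $t$-th roots of unity together with $r$ free reciprocal pairs. $\Phi_{2,R}$ has $R$ free variables and $\Phi_{1,R'}$ has $R'$ free variables; specialisation is of the Laurent polynomial $s_\lambda$. *)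

theory Defs
  imports
    Complex_Main
    "HOL-Library.Poly_Mapping"
    "HOL-Computational_Algebra.Polynomial_Factorial"
    "Jordan_Normal_Form.Determinant"
begin

text \<open>
  Laurent polynomials over the complex numbers in variables \<open>z 1, z 2, \<dots>\<close>: an exponent vector is a
  finitely supported function \<open>nat \<Rightarrow>\<^sub>0 int\<close>, and a Laurent polynomial assigns coefficients to
  finitely many exponent vectors. The index 0 is never used.
\<close>

type_synonym laurent = "(nat \<Rightarrow>\<^sub>0 int) \<Rightarrow>\<^sub>0 complex"

definition lconst :: "complex \<Rightarrow> laurent" where
  "lconst c = Poly_Mapping.single 0 c"

definition zpow :: "nat \<Rightarrow> int \<Rightarrow> laurent" where
  "zpow k e = Poly_Mapping.single (Poly_Mapping.single k e) 1"

text \<open>Integer powers of a unit \<open>u\<close>; the inverse of \<open>u\<close> is taken in the ring of Laurent polynomials.\<close>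

definition unit_pow :: "laurent \<Rightarrow> int \<Rightarrow> laurent" where
  "unit_pow u e = (if 0 \<le> e then u ^ nat e else (THE v. u * v = 1) ^ nat (- e))"

text \<open>Substitution of units \<open>u 1, u 2, \<dots>\<close> for the variables \<open>z 1, z 2, \<dots>\<close> of \<open>p\<close>.\<close>

definition lsubst :: "(nat \<Rightarrow> laurent) \<Rightarrow> laurent \<Rightarrow> laurent" where
  "lsubst u p = (\<Sum>e \<in> Poly_Mapping.keys p.
     lconst (Poly_Mapping.lookup p e) *
     (\<Prod>k \<in> Poly_Mapping.keys e. unit_pow (u k) (Poly_Mapping.lookup e k)))"

definition prim_root :: "nat \<Rightarrow> complex" where
  "prim_root t = exp (2 * of_real pi * \<i> / of_nat t)"

text \<open>
  The point \<open>(1, \<zeta>, \<dots>, \<zeta>\<^bsup>t-1\<^esup>, z\<^sub>1, z\<^sub>1\<^bsup>-1\<^esup>, z\<^sub>2, z\<^sub>2\<^bsup>-1\<^esup>, \<dots>)\<close>, with coordinates numbered from 1.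
\<close>

definition xpoint :: "nat \<Rightarrow> nat \<Rightarrow> laurent" where
  "xpoint t i =
     (if i \<le> t then lconst (prim_root t ^ (i - 1))
      else if odd (i - t) then zpow ((i - t + 1) div 2) 1
      else zpow ((i - t) div 2) (- 1))"

definition delta :: "nat \<Rightarrow> nat \<Rightarrow> int" where
  "delta N j = int N - int j"

text \<open>
  The indices \<open>i, j\<close> of \<open>x\<close> and \<open>\<beta>\<close> run over \<open>1, \<dots>, N\<close>, whereas matrix indices start at 0.
  Only nonnegative exponents occur, since \<open>\<beta>\<close> is strictly decreasing with last entry 0.
\<close>

definition alternant :: "nat \<Rightarrow> (nat \<Rightarrow> 'a :: comm_ring_1) \<Rightarrow> (nat \<Rightarrow> int) \<Rightarrow> 'a" where
  "alternant N x \<beta> = det (mat N N (\<lambda>(i, j). x (i + 1) ^ nat (\<beta> (j + 1))))"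

text \<open>
  The Laurent polynomial equal to the quotient of alternants, the quotient being formed in the
  fraction field. It exists and is unique by \<open>Phi_quotient\<close> and the injectivity of \<open>to_fract\<close>.
\<close>

definition Phi :: "nat \<Rightarrow> nat \<Rightarrow> (nat \<Rightarrow> int) \<Rightarrow> laurent" where
  "Phi t r \<beta> = (let N = t + 2 * r in
     THE p. to_fract p =
       to_fract (alternant N (xpoint t) \<beta>) / to_fract (alternant N (xpoint t) (delta N)))"


subsection \<open>The quotient is a Laurent polynomial\<close>

lemma power_expansion:
  fixes x :: "nat \<Rightarrow> 'a :: idom"
  shows "\<exists>c. \<forall>i<n. x i ^ a = (\<Sum>l<n. c l * x i ^ l)"
proof (induction a)
  case 0
  show ?case
  proof (intro exI allI impI)
    fix i assume "i < n"
    then have "(\<Sum>l<n. (if l = 0 then 1 else 0) * x i ^ l) = (\<Sum>l<n. if l = 0 then 1 else 0)"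
      by (intro sum.cong) auto
    also have "\<dots> = 1" using \<open>i < n\<close> by simp
    finally show "x i ^ 0 = (\<Sum>l<n. (if l = 0 then 1 else 0) * x i ^ l)" by simp
  qed
next
  case (Suc a)
  then obtain c where c: "\<And>i. i < n \<Longrightarrow> x i ^ a = (\<Sum>l<n. c l * x i ^ l)" by blast
  define P where "P = (\<Prod>k<n. [:- x k, 1:])"
  have deg: "degree P = n"
    unfolding P_def by (subst degree_prod_eq_sum_degree) auto
  have lead: "coeff P n = 1"
    using lead_coeff_prod[of "\<lambda>k. [:- x k, 1:]" "{..<n}"] deg by (simp add: P_def)
  have root: "x i ^ n = (\<Sum>l<n. - coeff P l * x i ^ l)" if "i < n" for i
  proof -
    have "poly P (x i) = 0"
      unfolding P_def poly_prod using that by (intro prod_zero) auto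
    moreover have "poly P (x i) = (\<Sum>l<n. coeff P l * x i ^ l) + x i ^ n"
      unfolding poly_altdef deg lessThan_Suc_atMost[symmetric] sum.lessThan_Suc lead by simp
    ultimately show ?thesis by (simp add: sum_negf eq_neg_iff_add_eq_0 add.commute)
  qed
  show ?case
  proof (cases n)
    case 0
    then show ?thesis by simp
  next
    case n: (Suc n')
    define d where "d l = (if l = 0 then 0 else c (l - 1)) - c n' * coeff P l" for l
    have "x i ^ Suc a = (\<Sum>l<n. d l * x i ^ l)" if i: "i < n" for i
    proof -
      have "x i ^ Suc a = (\<Sum>l<n. c l * x i ^ Suc l)"
        using c[OF i] by (simp add: sum_distrib_left algebra_simps)
      also have "\<dots> = (\<Sum>l<n'. c l * x i ^ Suc l) + c n' * x i ^ n"
        by (simp add: n)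
      also have "(\<Sum>l<n'. c l * x i ^ Suc l) = (\<Sum>l<n. (if l = 0 then 0 else c (l - 1)) * x i ^ l)"
        unfolding n by (subst sum.lessThan_Suc_shift) simp
      also have "\<dots> + c n' * x i ^ n = (\<Sum>l<n. d l * x i ^ l)"
        unfolding root[OF i] d_def
        by (simp add: sum_distrib_left sum.distrib[symmetric] algebra_simps sum_negf sum_subtractf)
      finally show ?thesis .
    qed
    then show ?thesis by blast
  qed
qed

lemma nat_delta: "nat (delta N (Suc l)) = N - Suc l"
  by (simp add: delta_def)

lemma alternant_delta_dvd:
  fixes x :: "nat \<Rightarrow> 'a :: idom"
  shows "alternant N x (delta N) dvd alternant N x \<beta>"
proof -
  have "\<forall>j. \<exists>c. \<forall>i<N. x (i + 1) ^ nat (\<beta> (j + 1)) = (\<Sum>l<N. c l * x (i + 1) ^ l)"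
    using power_expansion[of N "\<lambda>i. x (i + 1)"] by blast
  then obtain c where
    c: "\<And>j i. i < N \<Longrightarrow> x (i + 1) ^ nat (\<beta> (j + 1)) = (\<Sum>l<N. c j l * x (i + 1) ^ l)"
    by metis
  let ?V = "mat N N (\<lambda>(i, j). x (i + 1) ^ nat (delta N (j + 1)))"
  let ?C = "mat N N (\<lambda>(l, j). c j (N - Suc l))"
  have "mat N N (\<lambda>(i, j). x (i + 1) ^ nat (\<beta> (j + 1))) = ?V * ?C"
  proof (rule eq_matI, goal_cases)
    case (1 i j)
    then have i: "i < N" and j: "j < N" by auto
    have "(\<Sum>l<N. c j l * x (i + 1) ^ l) = (\<Sum>l<N. c j (N - Suc l) * x (i + 1) ^ (N - Suc l))"
      by (rule sum.nat_diff_reindex[symmetric])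
    also have "\<dots> = (\<Sum>l<N. x (i + 1) ^ nat (delta N (l + 1)) * c j (N - Suc l))"
      by (rule sum.cong) (auto simp: nat_delta mult.commute)
    finally show ?case
      using i j c[OF i, of j] by (simp add: scalar_prod_def lessThan_atLeast0)
  qed auto
  then show ?thesis
    unfolding alternant_def by (simp add: det_mult[of _ N])
qed

lemma alternant_delta_nonzero:
  fixes x :: "nat \<Rightarrow> 'a :: idom"
  assumes inj: "inj_on x {1..N}"
  shows "alternant N x (delta N) \<noteq> 0"
proof
  let ?V = "mat N N (\<lambda>(i, j). x (i + 1) ^ nat (delta N (j + 1)))"
  assume "alternant N x (delta N) = 0"
  then obtain v where v: "v \<in> carrier_vec N" "v \<noteq> 0\<^sub>v N" "?V *\<^sub>v v = 0\<^sub>v N"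
    unfolding alternant_def using det_0_iff_vec_prod_zero[of ?V N] by auto
  define p where "p = (\<Sum>l<N. monom (v $ (N - Suc l)) l)"
  have coeff: "coeff p l = (if l < N then v $ (N - Suc l) else 0)" for l
    by (simp add: p_def coeff_sum if_distrib[of "\<lambda>y. y = _"])
  have N: "N > 0" using v by (cases N) auto
  then have deg: "degree p < N"
    using degree_le[of "N - 1" p] coeff by fastforce
  have "poly p (x i) = 0" if "i \<in> {1..N}" for i
  proof -
    have i: "i - 1 < N" "i - 1 + 1 = i" using that by auto
    have "poly p (x i) = (\<Sum>l<N. v $ (N - Suc l) * x i ^ l)"
      by (simp add: p_def poly_sum poly_monom)
    also have "\<dots> = (\<Sum>l<N. v $ (N - Suc (N - Suc l)) * x i ^ (N - Suc l))"
      by (rule sum.nat_diff_reindex[symmetric])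
    also have "\<dots> = (\<Sum>l<N. x i ^ nat (delta N (l + 1)) * v $ l)"
      by (rule sum.cong) (auto simp: nat_delta mult.commute)
    also have "\<dots> = (?V *\<^sub>v v) $ (i - 1)"
      using v(1) i by (simp add: scalar_prod_def lessThan_atLeast0)
    also have "\<dots> = 0" using v(3) i by simp
    finally show ?thesis .
  qed
  then have "p = 0"
    using deg inj N
    by (intro poly_eqI_degree[where A = "x ` {1..N}"]) (auto simp: card_image)
  have "v = 0\<^sub>v N"
  proof (rule eq_vecI)
    fix l assume "l < dim_vec (0\<^sub>v N :: 'a vec)"
    then have "coeff p (N - Suc l) = v $ l" unfolding coeff by simp
    then show "v $ l = 0\<^sub>v N $ l" using \<open>p = 0\<close> \<open>l < _\<close> by simp
  qed (use v(1) in simp)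
  with v(2) show False by simp
qed

lemma inj_prim_root_power: "inj_on (\<lambda>k. prim_root t ^ k) {..<t}"
proof (cases "t = 0")
  case False
  have "prim_root t ^ k = cis (2 * pi * real k / real t)" for k
    by (simp add: prim_root_def cis_conv_exp exp_of_nat_mult[symmetric] algebra_simps)
  then show ?thesis
    using bij_betw_roots_unity[of t] False by (simp add: bij_betw_def)
qed simp

lemma single_eq_single_iff:
  "Poly_Mapping.single k c = Poly_Mapping.single l d \<longleftrightarrow> (k = l \<and> c = d) \<or> (c = 0 \<and> d = 0)"
  by (metis lookup_single_eq lookup_single_not_eq single_zero)

lemma zpow_neq_lconst:
  assumes "e \<noteq> 0"
  shows "zpow k e \<noteq> lconst c"
proof -
  have "Poly_Mapping.single k e \<noteq> 0"
    using assms by (metis lookup_single_eq lookup_zero)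
  then show ?thesis
    unfolding zpow_def lconst_def single_eq_single_iff by simp
qed

lemma zpow_eqD:
  assumes "zpow k e = zpow l d" and "e \<noteq> 0"
  shows "k = l" and "e = d"
  using assms unfolding zpow_def single_eq_single_iff by simp_all

lemma inj_xpoint: "inj_on (xpoint t) {1..N}"
proof (rule inj_onI)
  fix i j assume ij: "i \<in> {1..N}" "j \<in> {1..N}" and eq: "xpoint t i = xpoint t j"
  have lconst: "xpoint t i = lconst (prim_root t ^ (i - 1))" if "i \<le> t" for i
    using that by (simp add: xpoint_def)
  have zpow: "\<exists>k e. xpoint t i = zpow k e \<and> e \<noteq> 0 \<and> int (i - t) = 2 * int k - (if e = 1 then 1 else 0)"
    if "\<not> i \<le> t" for i
  proof (cases "odd (i - t)")
    case True
    then obtain b where "i - t = 2 * b + 1" by (rule oddE)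
    then have "xpoint t i = zpow (b + 1) 1" using that by (simp add: xpoint_def)
    then show ?thesis using \<open>i - t = _\<close>
      by (intro exI[of _ "b + 1"] exI[of _ "1 :: int"]) simp
  next
    case False
    then have "even (i - t)" by simp
    then obtain b where "i - t = 2 * b" by (rule evenE)
    then have "xpoint t i = zpow b (- 1)" using that by (simp add: xpoint_def)
    then show ?thesis using \<open>i - t = _\<close>
      by (intro exI[of _ b] exI[of _ "- 1 :: int"]) simp
  qed
  have mixed: "xpoint t i \<noteq> xpoint t j" if "i \<le> t" "\<not> j \<le> t" for i j
    using lconst[OF that(1)] zpow[OF that(2)] zpow_neq_lconst by metis
  consider "i \<le> t" "j \<le> t" | "\<not> i \<le> t" "\<not> j \<le> t"
    using mixed eq by metis
  then show "i = j"
  proof cases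
    case 1
    then have "lconst (prim_root t ^ (i - 1)) = lconst (prim_root t ^ (j - 1))"
      using eq lconst by metis
    then have "prim_root t ^ (i - 1) = prim_root t ^ (j - 1)"
      unfolding lconst_def single_eq_single_iff by metis
    moreover have "i - 1 < t" "j - 1 < t" using 1 ij by auto
    ultimately have "i - 1 = j - 1"
      using inj_onD[OF inj_prim_root_power[of t]] by auto
    then show ?thesis using ij by auto
  next
    case 2
    obtain k e where k: "xpoint t i = zpow k e" "e \<noteq> 0"
      "int (i - t) = 2 * int k - (if e = 1 then 1 else 0)"
      using zpow[OF 2(1)] by blast
    obtain l d where l: "xpoint t j = zpow l d"
      "int (j - t) = 2 * int l - (if d = 1 then 1 else 0)"
      using zpow[OF 2(2)] by blast
    have "k = l" "e = d" using zpow_eqD[of k e l d] k l eq by simp_all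
    then have "i - t = j - t" using k(3) l(2) by (metis of_nat_eq_iff)
    then show ?thesis using 2 by simp
  qed
qed

lemma Phi_quotient:
  assumes "N = t + 2 * r"
  shows "to_fract (Phi t r \<beta>) =
    to_fract (alternant N (xpoint t) \<beta>) / to_fract (alternant N (xpoint t) (delta N))"
proof -
  have nz: "alternant N (xpoint t) (delta N) \<noteq> 0"
    using alternant_delta_nonzero inj_xpoint by blast
  obtain q where q: "alternant N (xpoint t) \<beta> = alternant N (xpoint t) (delta N) * q"
    using alternant_delta_dvd[of N "xpoint t" \<beta>] by (elim dvdE)
  have "to_fract q =
      to_fract (alternant N (xpoint t) \<beta>) / to_fract (alternant N (xpoint t) (delta N))"
    using nz by (simp add: q)
  moreover have "p = q" if "to_fract p =
      to_fract (alternant N (xpoint t) \<beta>) / to_fract (alternant N (xpoint t) (delta N))" for p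
    using that calculation by (metis to_fract_eq_iff)
  ultimately show ?thesis
    unfolding Phi_def Let_def assms[symmetric] by (rule theI)
qed

end

theory Submission
  imports Defs
begin

text \<open>
  Substituting units is a ring homomorphism, hence maps the quotient of alternants at the point
  \<open>xpoint s\<close>, \<open>s \<in> {1, 2}\<close>, to the quotient of alternants at the substituted point. As the
  nontrivial \<open>t\<close>-th roots of unity other than \<open>-1\<close> come in \<open>m\<close> reciprocal pairs, the substituted
  point is a rearrangement of \<open>xpoint t\<close>, and a rearrangement multiplies numerator and denominator
  by the same sign.
\<close>

subsection \<open>Substitution of units\<close>

text \<open>An explicit inverse \<open>v\<close> removes both the \<open>THE\<close> and the sign
  distinction in \<open>unit_pow\<close>. Inverses are unique because
  \<open>w = w * (u * v) = v * (u * w) = v\<close>; common powers then cancel.\<close>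

lemma unit_pow_diff:
  assumes "u * v = 1"
  shows "unit_pow u (int a - int b) = u ^ a * v ^ b"
proof -
  have v: "(THE w. u * w = 1) = v"
  proof (rule the_equality)
    fix w assume "u * w = 1"
    moreover have "w * (u * v) = v * (u * w)" by (simp only: ac_simps)
    ultimately show "w = v" using assms by simp
  qed (fact assms)
  have cancel: "u ^ k * v ^ k = 1" for k
    using assms by (metis power_mult_distrib power_one)
  show ?thesis
  proof (cases "b \<le> a")
    case True
    then obtain d where d: "a = b + d" using le_Suc_ex by blast
    have "u ^ a * v ^ b = u ^ d * (u ^ b * v ^ b)" by (simp add: d power_add ac_simps)
    then show ?thesis using cancel by (simp add: unit_pow_def d)
  next
    case False
    then obtain d where d: "b = a + Suc d" by (metis add_Suc_right less_imp_Suc_add not_le)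
    have "u ^ a * v ^ b = v ^ Suc d * (u ^ a * v ^ a)" unfolding d power_add by (simp add: ac_simps)
    moreover have "unit_pow u (int a - int b) = v ^ Suc d"
      by (simp add: unit_pow_def v d nat_add_distrib)
    ultimately show ?thesis using cancel by simp
  qed
qed

lemma unit_pow_0 [simp]: "unit_pow u 0 = 1"
  and unit_pow_1 [simp]: "unit_pow u 1 = u"
  by (simp_all add: unit_pow_def)

lemma unit_pow_minus_1: "u * v = 1 \<Longrightarrow> unit_pow u (- 1) = v"
  using unit_pow_diff[of u v 0 1] by simp

lemma unit_pow_add:
  assumes "u dvd 1"
  shows "unit_pow u (e + f) = unit_pow u e * unit_pow u f"
proof -
  obtain v where v: "u * v = 1" using assms by (metis dvdE)
  obtain a b c d where ef: "e = int a - int b" "f = int c - int d"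
    by (metis int_diff_cases)
  have sum: "e + f = int (a + c) - int (b + d)" by (simp add: ef)
  show ?thesis
    unfolding sum unit_pow_diff[OF v] unfolding ef unit_pow_diff[OF v]
    by (simp add: power_add ac_simps)
qed

text \<open>The inner product of \<open>lsubst\<close>, named separately so that
  \<open>lsubst\<close> appears as the linear extension of a map on exponent vectors that turns sums
  into products.\<close>

definition monom_subst :: "(nat \<Rightarrow> laurent) \<Rightarrow> (nat \<Rightarrow>\<^sub>0 int) \<Rightarrow> laurent" where
  "monom_subst u e = (\<Prod>k \<in> Poly_Mapping.keys e. unit_pow (u k) (Poly_Mapping.lookup e k))"

text \<open>Exponents may cancel in a sum, so \<open>e\<close>, \<open>f\<close> and
  \<open>e + f\<close> have different keys. Over a common superset the extra factors have exponent 0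
  and equal 1.\<close>

lemma monom_subst_superset:
  assumes "finite A" and "Poly_Mapping.keys e \<subseteq> A"
  shows "monom_subst u e = (\<Prod>k \<in> A. unit_pow (u k) (Poly_Mapping.lookup e k))"
  unfolding monom_subst_def
  using assms by (intro prod.mono_neutral_left) (auto simp: in_keys_iff)

lemma monom_subst_0 [simp]: "monom_subst u 0 = 1"
  by (simp add: monom_subst_def)

lemma monom_subst_add:
  assumes "\<And>k. u k dvd 1"
  shows "monom_subst u (e + f) = monom_subst u e * monom_subst u f"
proof -
  let ?A = "Poly_Mapping.keys e \<union> Poly_Mapping.keys f"
  have "monom_subst u (e + f) =
      (\<Prod>k \<in> ?A. unit_pow (u k) (Poly_Mapping.lookup e k) * unit_pow (u k) (Poly_Mapping.lookup f k))"
    by (subst monom_subst_superset[of ?A])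
       (simp_all add: Poly_Mapping.keys_add lookup_add unit_pow_add assms)
  also have "\<dots> = monom_subst u e * monom_subst u f"
    by (simp add: prod.distrib monom_subst_superset[of ?A])
  finally show ?thesis .
qed

lemma monom_subst_single [simp]: "monom_subst u (Poly_Mapping.single k e) = unit_pow (u k) e"
  by (subst monom_subst_superset[of "{k}"]) auto

lemma lconst_0 [simp]: "lconst 0 = 0"
  and lconst_1 [simp]: "lconst 1 = 1"
  and lconst_add: "lconst (a + b) = lconst a + lconst b"
  and lconst_mult: "lconst (a * b) = lconst a * lconst b"
  by (simp_all add: lconst_def single_add mult_single)

lemma zpow_mult: "zpow k d * zpow k e = zpow k (d + e)"
  by (simp add: zpow_def mult_single single_add)

lemma zpow_0 [simp]: "zpow k 0 = 1"
  by (simp add: zpow_def)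

lemma lsubst_superset:
  assumes "finite A" and "Poly_Mapping.keys p \<subseteq> A"
  shows "lsubst u p = (\<Sum>e \<in> A. lconst (Poly_Mapping.lookup p e) * monom_subst u e)"
  unfolding lsubst_def monom_subst_def[symmetric]
  using assms by (intro sum.mono_neutral_left) (auto simp: in_keys_iff)

lemma lsubst_single: "lsubst u (Poly_Mapping.single e c) = lconst c * monom_subst u e"
  by (subst lsubst_superset[of "{e}"]) auto

lemma lsubst_add: "lsubst u (p + q) = lsubst u p + lsubst u q"
proof -
  let ?A = "Poly_Mapping.keys p \<union> Poly_Mapping.keys q"
  show ?thesis
    by (simp add: lsubst_superset[of ?A] Poly_Mapping.keys_add lookup_add lconst_add
        algebra_simps sum.distrib)
qed

lemma lsubst_lconst [simp]: "lsubst u (lconst c) = lconst c"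
  by (simp add: lconst_def[of c] lsubst_single)

lemma lsubst_zpow [simp]: "lsubst u (zpow k e) = unit_pow (u k) e"
  by (simp add: zpow_def lsubst_single)

lemma lsubst_0 [simp]: "lsubst u 0 = 0"
  by (simp add: lsubst_def)

text \<open>A finitely supported function is a finite sum of singles, so additive claims reduce to
  monomials. Zero is covered as a single with value 0.\<close>

lemma poly_mapping_single_induct [case_names single add]:
  fixes p :: "'a \<Rightarrow>\<^sub>0 'b :: comm_monoid_add"
  assumes single: "\<And>e c. P (Poly_Mapping.single e c)"
    and add: "\<And>p q. P p \<Longrightarrow> P q \<Longrightarrow> P (p + q)"
  shows "P p"
proof (induction p rule: update_induct)
  case const
  show ?case using single[of undefined 0] by simp
next
  case (update p e c)
  have "Poly_Mapping.update e c p = p + Poly_Mapping.single e c"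
    using update.hyps
    by (intro poly_mapping_eqI) (auto simp: lookup_update lookup_add lookup_single in_keys_iff)
  then show ?case using add update.IH single by metis
qed

text \<open>Both sides are additive in \<open>p\<close> and in \<open>q\<close>; a double induction
  leaves only two monomials, where \<open>monom_subst_add\<close> applies.\<close>

lemma lsubst_mult:
  assumes u: "\<And>k. u k dvd 1"
  shows "lsubst u (p * q) = lsubst u p * lsubst u q"
proof (induction p rule: poly_mapping_single_induct)
  case (single e c)
  show ?case
  proof (induction q rule: poly_mapping_single_induct)
    case (single f d)
    show ?case
      by (simp add: mult_single lsubst_single monom_subst_add[OF u] lconst_mult ac_simps)
  qed (simp_all add: lsubst_add distrib_left)
qed (simp_all add: lsubst_add distrib_right)

lemma comm_ring_hom_lsubst:
  assumes "\<And>k. u k dvd 1"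
  shows "comm_ring_hom (lsubst u)"
proof
  show "lsubst u 1 = 1" using lsubst_lconst[of u 1] by simp
qed (simp_all add: lsubst_add lsubst_mult assms)

subsection \<open>Alternants\<close>

lemma (in comm_ring_hom) hom_alternant:
  "hom (alternant N x \<beta>) = alternant N (\<lambda>i. hom (x i)) \<beta>"
  unfolding alternant_def hom_det[symmetric]
  by (intro arg_cong[where f = det] eq_matI) (auto simp: hom_power)

text \<open>Permuting the coordinates permutes the rows. The shift by one in
  \<open>x (Suc (\<pi> (i - 1)))\<close> reconciles coordinates counted from 1 with rows counted
  from 0.\<close>

lemma alternant_permute:
  assumes "\<pi> permutes {0..<N}"
  shows "alternant N (\<lambda>i. x (Suc (\<pi> (i - 1)))) \<beta> = of_int (sign \<pi>) * alternant N x \<beta>"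
proof -
  let ?A = "mat N N (\<lambda>(i, j). x (i + 1) ^ nat (\<beta> (j + 1)))"
  have "alternant N (\<lambda>i. x (Suc (\<pi> (i - 1)))) \<beta> = det (mat N N (\<lambda>(i, j). ?A $$ (\<pi> i, j)))"
    unfolding alternant_def using permutes_in_image[OF assms]
    by (intro arg_cong[where f = det] eq_matI) auto
  also have "\<dots> = signof \<pi> * det ?A"
    by (rule det_permute_rows[OF _ assms]) simp
  finally show ?thesis by (simp add: alternant_def)
qed

text \<open>Counting turns the inclusion into equality of the two value sets and makes
  \<open>y\<close> injective, so \<open>y\<close> is a permutation of \<open>x\<close>. The factor
  \<open>s\<close> is its sign: the same for every \<open>\<beta>\<close>, and cancellable because
  \<open>s * s = 1\<close>.\<close>

lemma alternant_rearrange: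
  fixes x y :: "nat \<Rightarrow> 'a :: comm_ring_1"
  assumes inj: "inj_on x {1..N}" and sub: "x ` {1..N} \<subseteq> y ` {1..N}"
  obtains s :: 'a where "s * s = 1" and "\<And>\<beta>. alternant N y \<beta> = s * alternant N x \<beta>"
proof -
  have "card (x ` {1..N}) = N" using inj by (simp add: card_image)
  then have eq: "x ` {1..N} = y ` {1..N}"
    using sub by (intro card_seteq) (auto intro: card_image_le[of "{1..N}" y, simplified])
  then have injy: "inj_on y {1..N}"
    using \<open>card _ = N\<close> by (intro eq_card_imp_inj_on) auto
  have shift: "bij_betw Suc {0..<N} {1..N}"
    by (simp add: bij_betw_def image_Suc_atLeastLessThan atLeastLessThanSuc_atLeastAtMost)
  have X: "bij_betw (x \<circ> Suc) {0..<N} (x ` {1..N})"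
    by (rule bij_betw_trans[OF shift inj_on_imp_bij_betw[OF inj]])
  have Y: "bij_betw (y \<circ> Suc) {0..<N} (x ` {1..N})"
    unfolding eq by (rule bij_betw_trans[OF shift inj_on_imp_bij_betw[OF injy]])
  \<comment> \<open>\<open>g k\<close> is the row in which \<open>x\<close> takes the value that
    \<open>y\<close> has in row \<open>k\<close>; \<open>\<pi>\<close> extends it by the identity,
    as \<open>permutes\<close> demands.\<close>
  define g where "g = inv_into {0..<N} (x \<circ> Suc) \<circ> (y \<circ> Suc)"
  define \<pi> where "\<pi> k = (if k \<in> {0..<N} then g k else k)" for k
  have "bij_betw g {0..<N} {0..<N}"
    unfolding g_def by (rule bij_betw_trans[OF Y bij_betw_inv_into[OF X]])
  then have "bij_betw \<pi> {0..<N} {0..<N}"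
    by (rule iffD1[OF bij_betw_cong, rotated]) (simp add: \<pi>_def)
  then have perm: "\<pi> permutes {0..<N}"
    by (rule bij_imp_permutes) (simp add: \<pi>_def)
  have yx: "y (Suc i) = x (Suc (\<pi> i))" if "i < N" for i
  proof -
    have "y (Suc i) \<in> (x \<circ> Suc) ` {0..<N}"
      using Y X that by (auto simp: bij_betw_def)
    from f_inv_into_f[OF this] show ?thesis using that by (simp add: \<pi>_def g_def)
  qed
  show ?thesis
  proof
    show "of_int (sign \<pi>) * of_int (sign \<pi>) = (1 :: 'a)" by (simp add: sign_def)
    fix \<beta>
    have "alternant N y \<beta> = alternant N (\<lambda>i. x (Suc (\<pi> (i - 1)))) \<beta>"
      unfolding alternant_def by (intro arg_cong[where f = det] eq_matI) (auto simp: yx)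
    also have "\<dots> = of_int (sign \<pi>) * alternant N x \<beta>"
      by (rule alternant_permute[OF perm])
    finally show "alternant N y \<beta> = of_int (sign \<pi>) * alternant N x \<beta>" .
  qed
qed

subsection \<open>The substituted point\<close>

lemma prim_root_power_self: "t \<ge> 1 \<Longrightarrow> prim_root t ^ t = 1"
  by (simp add: prim_root_def exp_of_nat_mult[symmetric])

lemma prim_root_2 [simp]: "prim_root 2 = - 1"
  by (simp add: prim_root_def)

lemma prim_root_nonzero [simp]: "prim_root t \<noteq> 0"
  by (simp add: prim_root_def)

lemma prim_root_half: "m \<ge> 1 \<Longrightarrow> prim_root (2 * m) ^ m = - 1"
  by (simp add: prim_root_def exp_of_nat_mult[symmetric])

lemma xpoint_root: "i < t \<Longrightarrow> xpoint t (Suc i) = lconst (prim_root t ^ i)"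
  by (simp add: xpoint_def)

lemma xpoint_zpow: "xpoint t (t + 2 * k + 1) = zpow (Suc k) 1"
  by (simp add: xpoint_def)

lemma xpoint_zpow_inverse: "xpoint t (t + 2 * k + 2) = zpow (Suc k) (- 1)"
  by (simp add: xpoint_def)

abbreviation (input) root_subst :: "nat \<Rightarrow> nat \<Rightarrow> nat \<Rightarrow> laurent" where
  "root_subst t m k \<equiv> if k \<le> m then lconst (prim_root t ^ k) else zpow (k - m) 1"

lemma lconst_power_inverse: "lconst (prim_root t ^ k) * lconst (inverse (prim_root t) ^ k) = 1"
  by (simp add: lconst_mult[symmetric] power_mult_distrib[symmetric])

lemma zpow_inverse: "zpow k 1 * zpow k (- 1) = 1"
  by (simp add: zpow_mult)

lemma root_subst_unit: "root_subst t m k dvd 1"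
  using lconst_power_inverse zpow_inverse by (metis dvdI)

text \<open>The exponents \<open>1, \<dots>, m\<close> of the root of unity are the substituted
  values and the last \<open>m\<close> exponents below \<open>t\<close> are their inverses. Between
  them lie 0 and, for \<open>s = 2\<close>, also \<open>Suc m\<close>, giving 1 and -1, the
  \<open>s\<close>-th roots of unity.\<close>

lemma xpoint_subset_lsubst_xpoint:
  assumes s: "s = 1 \<or> s = 2" and t: "t = s + 2 * m" and N: "N = t + 2 * r"
  shows "xpoint t ` {1..N} \<subseteq> (\<lambda>i. lsubst (root_subst t m) (xpoint s i)) ` {1..N}"
    (is "_ \<subseteq> ?Y")
proof
  have pos: "xpoint s (s + 2 * k + 1) = zpow (Suc k) 1"
    and neg: "xpoint s (s + 2 * k + 2) = zpow (Suc k) (- 1)" for k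
    by (rule xpoint_zpow xpoint_zpow_inverse)+
  \<comment> \<open>Three kinds of members of \<open>?Y\<close>: images of variables, images of
    their inverses, and the constants, which \<open>lsubst\<close> fixes.\<close>
  have Y_pos: "root_subst t m (Suc k) \<in> ?Y" if "k < m + r" for k
    using that
    by (intro image_eqI[of _ _ "s + 2 * k + 1"], unfold pos lsubst_zpow) (simp_all add: t N)
  have Y_neg: "unit_pow (root_subst t m (Suc k)) (- 1) \<in> ?Y" if "k < m + r" for k
    using that
    by (intro image_eqI[of _ _ "s + 2 * k + 2"], unfold neg lsubst_zpow) (simp_all add: t N)
  have Y_root: "lconst (prim_root s ^ k) \<in> ?Y" if "k < s" for k
    using that by (intro image_eqI[of _ _ "Suc k"]) (simp_all add: xpoint_root t N)
  have "t \<ge> 1" using s t by auto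
  fix z assume "z \<in> xpoint t ` {1..N}"
  then obtain i where i: "i < N" "z = xpoint t (Suc i)"
    by (auto simp: Suc_le_eq gr0_conv_Suc)
  \<comment> \<open>In order: the root 1, the substituted roots, the root -1 for even
    \<open>t\<close>, the inverses of the substituted roots, the free variables, and their
    inverses.\<close>
  consider "i = 0" | k where "i = Suc k" "k < m" | "s = 2" "i = Suc m"
    | k where "i + Suc k = t" "k < m"
    | k where "i = t + 2 * k" "k < r" | k where "i = t + 2 * k + 1" "k < r"
  proof -
    have root: "i = 0 \<or> i = Suc (i - 1) \<and> i - 1 < m \<or> s = 2 \<and> i = Suc m
        \<or> i + Suc (t - Suc i) = t \<and> t - Suc i < m" if "i < t"
      using that s t by auto
    have "i = t + 2 * ((i - t) div 2) \<or> i = t + 2 * ((i - t) div 2) + 1"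
      and "(i - t) div 2 < r" if "\<not> i < t"
      using that i(1) N by presburger+
    then show thesis using that root by blast
  qed
  then show "z \<in> ?Y"
  proof cases
    case 1
    then show ?thesis using Y_root[of 0] s \<open>t \<ge> 1\<close> i by (auto simp: xpoint_root)
  next
    case (2 k)
    then show ?thesis using Y_pos[of k] i t by (simp add: xpoint_root)
  next
    case 3
    have "prim_root t ^ i = prim_root s ^ 1"
      using prim_root_half[of "Suc m"] 3 by (simp add: t)
    then show ?thesis using Y_root[of 1] 3 i t by (simp add: xpoint_root)
  next
    case (4 k)
    \<comment> \<open>The exponents add up to \<open>t\<close>, so this root is the inverse of the
      one substituted for variable \<open>Suc k\<close>.\<close>
    have "prim_root t ^ i * prim_root t ^ Suc k = 1"
      using prim_root_power_self[OF \<open>t \<ge> 1\<close>] 4 by (metis power_add)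
    then have "lconst (prim_root t ^ Suc k) * lconst (prim_root t ^ i) = 1"
      by (simp add: lconst_mult[symmetric] mult.commute)
    then have "unit_pow (lconst (prim_root t ^ Suc k)) (- 1) = lconst (prim_root t ^ i)"
      by (rule unit_pow_minus_1)
    then show ?thesis using Y_neg[of k] 4 i by (simp add: xpoint_root)
  next
    case (5 k)
    \<comment> \<open>Variable \<open>Suc (m + k)\<close> lies beyond the first \<open>m\<close>,
      and is renamed to variable \<open>Suc k\<close>.\<close>
    then show ?thesis using Y_pos[of "m + k"] i xpoint_zpow[of t k] by simp
  next
    case (6 k)
    then show ?thesis
      using Y_neg[of "m + k"] i xpoint_zpow_inverse[of t k] unit_pow_minus_1[OF zpow_inverse]
      by simp
  qed
qed

text \<open>Clearing the denominator moves the quotient from the fraction field to the Laurent ring,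
  where \<open>lsubst\<close> acts.\<close>

lemma alternant_delta_mult_Phi:
  assumes "N = t + 2 * r"
  shows "alternant N (xpoint t) (delta N) * Phi t r \<beta> = alternant N (xpoint t) \<beta>"
proof -
  have "alternant N (xpoint t) (delta N) \<noteq> 0"
    using alternant_delta_nonzero inj_xpoint by blast
  then have "to_fract (alternant N (xpoint t) (delta N) * Phi t r \<beta>)
      = to_fract (alternant N (xpoint t) \<beta>)"
    by (simp add: Phi_quotient[OF assms])
  then show ?thesis by (simp only: to_fract_eq_iff)
qed

text \<open>Treats both parities at once: \<open>s = 2\<close> for even \<open>t\<close>,
  \<open>s = 1\<close> for odd \<open>t\<close>.\<close>

lemma Phi_eq_lsubst_Phi:
  assumes s: "s = 1 \<or> s = 2" and t: "t = s + 2 * m"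
  shows "Phi t r \<beta> = lsubst (root_subst t m) (Phi s (r + m) \<beta>)"
proof -
  define N where "N = t + 2 * r"
  have Ns: "N = s + 2 * (r + m)" by (simp add: N_def t)
  let ?h = "lsubst (root_subst t m)"
  let ?y = "\<lambda>i. ?h (xpoint s i)"
  interpret comm_ring_hom ?h
    by (rule comm_ring_hom_lsubst) (rule root_subst_unit)
  obtain c where c: "c * c = 1"
      "\<And>\<beta>. alternant N ?y \<beta> = c * alternant N (xpoint t) \<beta>"
    by (rule alternant_rearrange[OF inj_xpoint xpoint_subset_lsubst_xpoint[OF s t N_def]])
      (rule that)
  let ?D = "alternant N (xpoint t) (delta N)"
  \<comment> \<open>The homomorphism is applied to numerator and denominator at
    \<open>xpoint s\<close>; rearranging to \<open>xpoint t\<close> produces the same sign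
    \<open>c\<close> in both.\<close>
  have "c * ?D * ?h (Phi s (r + m) \<beta>) = ?h (alternant N (xpoint s) (delta N) * Phi s (r + m) \<beta>)"
    by (simp only: hom_mult hom_alternant c)
  also have "\<dots> = c * alternant N (xpoint t) \<beta>"
    by (simp only: alternant_delta_mult_Phi[OF Ns] hom_alternant c)
  also have "\<dots> = c * ?D * Phi t r \<beta>"
    by (simp only: alternant_delta_mult_Phi[OF N_def] mult.assoc)
  finally have "c * ?D * ?h (Phi s (r + m) \<beta>) = c * ?D * Phi t r \<beta>" .
  \<comment> \<open>\<open>c\<close> is nonzero because its square is 1, and \<open>?D\<close>
    because the coordinates of \<open>xpoint t\<close> are distinct; Laurent polynomials form an
    integral domain.\<close>
  moreover have "c * ?D \<noteq> 0"
    using c(1) alternant_delta_nonzero[OF inj_xpoint, of N t] by auto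
  ultimately have "?h (Phi s (r + m) \<beta>) = Phi t r \<beta>"
    using mult_left_cancel by blast
  then show ?thesis by (rule sym)
qed

theorem proposition2p1:
  fixes t r :: nat and \<beta> :: "nat \<Rightarrow> int"
  assumes "t \<ge> 1" and "r \<ge> 1"
    and "strict_antimono_on {1..t + 2 * r} \<beta>"
    and "\<beta> (t + 2 * r) = 0"
  shows "(\<forall>m R. t = 2 * m + 2 \<and> R = r + m \<longrightarrow>
            2 + 2 * R = t + 2 * r \<and>
            Phi t r \<beta> =
              lsubst (\<lambda>k. if k \<le> m then lconst (prim_root t ^ k) else zpow (k - m) 1) (Phi 2 R \<beta>)) \<and>
         (\<forall>m' R'. t = 2 * m' + 1 \<and> R' = r + m' \<longrightarrow>
            1 + 2 * R' = t + 2 * r \<and>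
            Phi t r \<beta> =
              lsubst (\<lambda>k. if k \<le> m' then lconst (prim_root t ^ k) else zpow (k - m') 1) (Phi 1 R' \<beta>))"
proof (intro conjI allI impI; elim conjE)
  fix m R assume "t = 2 * m + 2" and R: "R = r + m"
  then have "t = 2 + 2 * m" by simp
  then show "Phi t r \<beta> = lsubst (root_subst t m) (Phi 2 R \<beta>)"
    unfolding R by (intro Phi_eq_lsubst_Phi) simp
next
  fix m' R' assume "t = 2 * m' + 1" and R': "R' = r + m'"
  then have "t = 1 + 2 * m'" by simp
  then show "Phi t r \<beta> = lsubst (root_subst t m') (Phi 1 R' \<beta>)"
    unfolding R' by (intro Phi_eq_lsubst_Phi) simp
qed simp_all

end
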